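(* Let $A_n=\frac{1}{\sqrt n}(a_{ij})_{i,j=1}^n$ be a matrix from the Gaussian Orthogonal Ensemble, i.e. a real symmetric $n\times n$ matrix with $\{a_{ij}=a_{ji}\}_{i\le j}$ independent $N(0,1+\delta_{ij})$ random variables. For $z\in\mathbb{C}$ with $\Im z\neq 0$ set $G_n(z)=(A_n-2-z n^{-2/3})^{-1}$ (where $A_n-w$ means $A_n-w\,\mathrm{Id}$), $g_{n,k}(z)=n^{-2k/3}\,\mathrm{Tr}\,G_n^k(z)$ for integers $k\ge 2$, and $g^c_{n,1}(z)=n^{-2/3}\left(n+\mathrm{Tr}\,G_n(z)\right)$. For a multi-index $K=(k_1,\dots,k_j)$, $j\ge1$, of nonnegative integers, let $$m_K=\mathbb{E}\Big((g^c_{n,1}(z))^{k_1}\prod_{l=2}^j (g_{n,l}(z))^{k_l}\Big),$$ and let $e_l$ denote the multi-index whose $l$-th component is $1$ and all other components are $0$. Then for every non-zero multi-index $K$, $$m_K\,(z+O(n^{-2/3}))-m_{K+2e_1}(1+O(n^{-2/3}))-m_{K+e_2}(1+O(n^{-2/3}))-2\sum_{l\ge1} l\,k_l\, m_{K-e_l+e_{l+2}}(1+O(n^{-2/3}))=O(n^{-1/3})\,m_{K+e_1},$$ where the term $k_l\, m_{K-e_l+e_{l+2}}$ is interpreted as $0$ when $k_l=0$. Moreover, the following boundary condition holds: $$z+O(n^{-2/3})-m_{2e_1}(1+O(n^{-2/3}))-m_{e_2}(1+O(n^{-2/3}))=O(n^{-1/3})\,m_{e_1}.$$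
   Context: Multi-indices are added componentwise, extending by zero components as needed (a component beyond the length of a multi-index is $0$, i.e. the corresponding factor is absent from $m_K$). The symbols $O(n^{-a})$ denote (possibly different) quantities, as $n\to\infty$, bounded in absolute value by a constant times $n^{-a}$. *)

theory Defs
  imports "HOL-Probability.Probability" "Jordan_Normal_Form.Gauss_Jordan_Elimination"
begin

(* Multi-indices K = (k_1,...,k_j) are lists; component l (1-based) is K!(l-1),
   and components beyond the length are 0. *)
definition mcomp :: "nat list \<Rightarrow> nat \<Rightarrow> nat" where
  "mcomp K l = (if 1 \<le> l \<and> l \<le> length K then K ! (l - 1) else 0)"

definition madd :: "nat list \<Rightarrow> nat list \<Rightarrow> nat list" where
  "madd K L = map (\<lambda>i. mcomp K i + mcomp L i) [1..<max (length K) (length L) + 1]"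

(* componentwise (truncated) subtraction, only used when it does not truncate *)
definition msub :: "nat list \<Rightarrow> nat list \<Rightarrow> nat list" where
  "msub K L = map (\<lambda>i. mcomp K i - mcomp L i) [1..<max (length K) (length L) + 1]"

definition unit_mi :: "nat \<Rightarrow> nat list" where
  "unit_mi l = replicate (l - 1) 0 @ [1]"

definition goe_idx :: "nat \<Rightarrow> (nat \<times> nat) set" where
  "goe_idx n = {(i, j). i \<le> j \<and> j < n}"

definition goe :: "nat \<Rightarrow> ((nat \<times> nat) \<Rightarrow> real) measure" where
  "goe n = PiM (goe_idx n)
     (\<lambda>(i, j). if i = j then density lborel (normal_density 0 (sqrt 2))
               else density lborel (normal_density 0 1))"

definition goe_mat :: "nat \<Rightarrow> ((nat \<times> nat) \<Rightarrow> real) \<Rightarrow> complex mat" where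
  "goe_mat n a = mat n n (\<lambda>(i, j). complex_of_real (a (min i j, max i j) / sqrt (real n)))"

definition mat_trace :: "complex mat \<Rightarrow> complex" where
  "mat_trace A = (\<Sum>i<dim_row A. A $$ (i, i))"

definition resolv :: "nat \<Rightarrow> complex \<Rightarrow> ((nat \<times> nat) \<Rightarrow> real) \<Rightarrow> complex mat" where
  "resolv n z a = the (mat_inverse
      (goe_mat n a - (2 + z * complex_of_real (real n powr (-2/3))) \<cdot>\<^sub>m 1\<^sub>m n))"

definition gnk :: "nat \<Rightarrow> nat \<Rightarrow> complex \<Rightarrow> ((nat \<times> nat) \<Rightarrow> real) \<Rightarrow> complex" where
  "gnk n k z a = complex_of_real (real n powr (- 2 * real k / 3)) * mat_trace (resolv n z a ^\<^sub>m k)"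

definition gc1 :: "nat \<Rightarrow> complex \<Rightarrow> ((nat \<times> nat) \<Rightarrow> real) \<Rightarrow> complex" where
  "gc1 n z a = complex_of_real (real n powr (-2/3)) * (of_nat n + mat_trace (resolv n z a))"

definition mK :: "nat \<Rightarrow> complex \<Rightarrow> nat list \<Rightarrow> complex" where
  "mK n z K = (LINT a|goe n. gc1 n z a ^ mcomp K 1 *
                 (\<Prod>l\<in>{2..length K}. gnk n l z a ^ mcomp K l))"

definition bigO_seq :: "(nat \<Rightarrow> complex) \<Rightarrow> real \<Rightarrow> bool" where
  "bigO_seq f p \<longleftrightarrow> (\<exists>C N. \<forall>n\<ge>N. cmod (f n) \<le> C * real n powr (- p))"

end

theory Submission
  imports Defs "HOL-Real_Asymp.Real_Asymp" "Jordan_Normal_Form.Determinant"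
begin

text \<open>
  The identity holds exactly for every \<open>n > 0\<close>: the error terms of order \<open>n^(-2/3)\<close> can be taken to
  be 0 and the coefficient on the right to be \<open>z n^(-1/3)\<close>. With \<open>w = 2 + z n^(-2/3)\<close> and
  \<open>G = (A - w)^(-1)\<close> we have \<open>n + w Tr G = Tr (A G)\<close>. Multiply by the monomial
  \<open>\<Phi> = \<Prod> g_l^(k_l)\<close>, where \<open>g_l = c_l Tr G^l\<close> (centred for \<open>l = 1\<close>) and \<open>c_l = n^(-2l/3)\<close>, and
  integrate by parts in each Gaussian entry of \<open>A\<close>. Since \<open>dG = - G dA G\<close>,
  \<open>E ((n + w Tr G) \<Phi>) = - 1/n E ((Tr G^2 + (Tr G)^2) \<Phi>) - 2/n E (\<Sum> l k_l c_l Tr G^(l+2) \<Phi> / g_l)\<close>.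
  Expressing the traces through the \<open>g_l\<close> and dividing by \<open>n^(1/3)\<close> gives the claim. As \<open>Im w \<noteq> 0\<close>,
  the entries of \<open>G\<close> are bounded by \<open>1 / \<bar>Im w\<bar>\<close>, so all expectations exist.
\<close>

subsection \<open>Gaussian integration by parts\<close>

text \<open>The Gaussian density \<open>d\<close> satisfies
  \<open>d' x = - (x / sigma^2) d x\<close>, so the claim says that the derivative of
  \<open>d f\<close> has integral zero over the line. Boundedness of \<open>f\<close> and
  \<open>f'\<close> gives both integrability and vanishing boundary values.\<close>

lemma gaussian_ibp:
  fixes f f' :: "real \<Rightarrow> complex"
  assumes \<sigma>: "\<sigma> > 0"
    and der: "\<And>x. (f has_vector_derivative f' x) (at x)"
    and cont: "\<And>x. isCont f' x"
    and bd: "\<And>x. norm (f x) \<le> B" and bd': "\<And>x. norm (f' x) \<le> B'"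
  shows "(LINT x|density lborel (normal_density 0 \<sigma>). x *\<^sub>R f x) =
    \<sigma>\<^sup>2 *\<^sub>R (LINT x|density lborel (normal_density 0 \<sigma>). f' x)"
proof -
  let ?d = "normal_density 0 \<sigma>"
  have ddens: "(?d has_real_derivative - (x / \<sigma>\<^sup>2) * ?d x) (at x)" for x
    unfolding normal_density_def
    by (rule derivative_eq_intros refl | use \<sigma> in \<open>simp add: field_simps\<close>)+
  have contf: "continuous_on UNIV f"
    using der has_vector_derivative_continuous by (fastforce simp: continuous_on_eq_continuous_at)
  have [measurable]: "f \<in> borel_measurable borel" "f' \<in> borel_measurable borel"
    using contf cont by (auto intro!: borel_measurable_continuous_onI simp: continuous_on_eq_continuous_at)
  define g where "g x = ?d x *\<^sub>R f x" for x
  define g' where "g' x = ?d x *\<^sub>R f' x - (x / \<sigma>\<^sup>2 * ?d x) *\<^sub>R f x" for x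
  have dg: "(g has_vector_derivative g' x) (at x)" for x
    unfolding g_def[abs_def] g'_def
    by (rule derivative_eq_intros ddens der refl | simp)+
  have isc: "isCont g' x" for x
    unfolding g'_def[abs_def] normal_density_def
    by (intro continuous_intros cont has_vector_derivative_continuous[OF der]) (use \<sigma> in auto)
  have i1: "integrable lborel (\<lambda>x. ?d x *\<^sub>R f' x)"
  proof (rule Bochner_Integration.integrable_bound)
    show "integrable lborel (\<lambda>x. B' * ?d x)" using \<sigma> by auto
    have "B' \<ge> 0" using bd'[of 0] norm_ge_zero order_trans by blast
    then show "AE x in lborel. norm (?d x *\<^sub>R f' x) \<le> norm (B' * ?d x)"
      using bd' by (auto intro!: AE_I2 mult_right_mono simp: abs_mult mult.commute[of B'] intro: mult_left_mono)
  qed measurable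
  \<comment> \<open>The factor \<open>x\<close> is unbounded here; the first absolute moment of the
    Gaussian serves as majorant.\<close>
  have i2: "integrable lborel (\<lambda>x. (?d x * x) *\<^sub>R f x)"
  proof (rule Bochner_Integration.integrable_bound)
    show "integrable lborel (\<lambda>x. B * (?d x * \<bar>x\<bar>))" 
      using integrable_normal_moment_abs[OF \<sigma>, of 0 1] by simp
    have "B \<ge> 0" using bd[of 0] norm_ge_zero order_trans by blast
    then show "AE x in lborel. norm ((?d x * x) *\<^sub>R f x) \<le> norm (B * (?d x * \<bar>x\<bar>))"
      using bd by (auto intro!: AE_I2 simp: abs_mult mult.commute[of B] intro: mult_left_mono)
  qed measurable
  have g'eq: "g' x = ?d x *\<^sub>R f' x - (1 / \<sigma>\<^sup>2) *\<^sub>R ((?d x * x) *\<^sub>R f x)" for x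
    by (simp add: g'_def field_simps)
  have ig: "integrable lborel g'"
    unfolding g'eq[abs_def]
    by (intro Bochner_Integration.integrable_diff integrable_scaleR_right i1 i2)
  have lim: "((\<lambda>x. ?d x) \<longlongrightarrow> 0) at_top" "((\<lambda>x. ?d x) \<longlongrightarrow> 0) at_bot"
    unfolding normal_density_def using \<sigma> by real_asymp+
  have limg: "(g \<longlongrightarrow> 0) F" if "((\<lambda>x. ?d x) \<longlongrightarrow> 0) F" for F
  proof (rule Lim_null_comparison)
    show "\<forall>\<^sub>F x in F. norm (g x) \<le> ?d x * B"
      using bd by (auto simp: g_def intro!: always_eventually mult_left_mono)
    show "((\<lambda>x. ?d x * B) \<longlongrightarrow> 0) F" using tendsto_mult_right[OF that, of B] by (simp add: mult.commute)
  qed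
  \<comment> \<open>The two zeros are the limits of \<open>g\<close> at the ends of the line, where
    the density vanishes and \<open>f\<close> stays bounded.\<close>
  have "(LBINT x=-\<infinity>..\<infinity>. g' x) = 0 - 0"
  proof (rule interval_integral_FTC_integrable)
    show "((g \<circ> real_of_ereal) \<longlongrightarrow> 0) (at_right (-\<infinity>))" "((g \<circ> real_of_ereal) \<longlongrightarrow> 0) (at_left \<infinity>)"
      using limg lim by (simp_all add: ereal_tendsto_simps1)
  qed (use dg isc ig in \<open>auto simp: set_integrable_def\<close>)
  then have "integral\<^sup>L lborel g' = 0"
    by (simp add: interval_lebesgue_integral_def set_lebesgue_integral_def)
  moreover have "integral\<^sup>L lborel g' = (LINT x|lborel. ?d x *\<^sub>R f' x) - (1 / \<sigma>\<^sup>2) *\<^sub>R (LINT x|lborel. (?d x * x) *\<^sub>R f x)"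
    unfolding g'eq[abs_def]
    by (subst Bochner_Integration.integral_diff[OF i1 integrable_scaleR_right[OF i2]]) (simp only: integral_scaleR_right)
  ultimately have "(LINT x|lborel. (?d x * x) *\<^sub>R f x) = \<sigma>\<^sup>2 *\<^sub>R (LINT x|lborel. ?d x *\<^sub>R f' x)"
    using \<sigma> by (simp add: field_simps)
  then show ?thesis
    by (simp add: integral_density)
qed

section \<open>The ensemble as a finite product of Gaussian laws\<close>

definition goe_sd :: "nat \<times> nat \<Rightarrow> real" where
  "goe_sd p = (if fst p = snd p then sqrt 2 else 1)"

lemma goe_sd_pos: "goe_sd p > 0"
  by (simp add: goe_sd_def)

definition goe_marginal :: "nat \<times> nat \<Rightarrow> real measure" where
  "goe_marginal p = density lborel (normal_density 0 (goe_sd p))"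

lemma goe_eq_PiM: "goe n = PiM (goe_idx n) goe_marginal"
  unfolding goe_def by (rule PiM_cong) (auto simp: goe_marginal_def goe_sd_def)

lemma prob_space_goe_marginal: "prob_space (goe_marginal p)"
  unfolding goe_marginal_def by (rule prob_space_normal_density) (rule goe_sd_pos)

interpretation goe_product: product_prob_space goe_marginal "goe_idx n" for n
proof -
  interpret prob_space "goe_marginal p" for p by (rule prob_space_goe_marginal)
  show "product_prob_space goe_marginal" by unfold_locales
qed

lemma finite_goe_idx: "finite (goe_idx n)"
  by (rule finite_subset[of _ "{..<n} \<times> {..<n}"]) (auto simp: goe_idx_def)

lemma prob_space_goe: "prob_space (goe n)"
  unfolding goe_eq_PiM by (rule prob_space_PiM) (rule prob_space_goe_marginal)

lemma sets_goe_marginal [measurable_cong]: "sets (goe_marginal p) = sets borel"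
  by (simp add: goe_marginal_def)

lemma measurable_goe_component:
  assumes "p \<in> goe_idx n"
  shows "(\<lambda>a. a p) \<in> borel_measurable (goe n)"
  using measurable_component_singleton[OF assms, of goe_marginal]
  unfolding goe_eq_PiM by (simp cong: measurable_cong_sets add: sets_goe_marginal)

lemma integrable_goe_component:
  assumes p: "p \<in> goe_idx n"
  shows "integrable (goe n) (\<lambda>a. a p)"
proof -
  have "integrable (goe_marginal p) (\<lambda>x. x)"
    unfolding goe_marginal_def using integrable_normal_moment_nz_1[OF goe_sd_pos, of 0 p]
    by (subst integrable_density) (auto simp: normal_density_nonneg)
  then have "integrable (distr (goe n) (goe_marginal p) (\<lambda>a. a p)) (\<lambda>x. x)"
    using distr_PiM_component[of "goe_idx n" goe_marginal, OF prob_space_goe_marginal p]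
    by (simp add: goe_eq_PiM)
  then show ?thesis
    by (subst (asm) integrable_distr_eq)
      (use measurable_goe_component[OF p] in \<open>auto cong: measurable_cong_sets simp: sets_goe_marginal\<close>)
qed

lemma integrable_goe_bounded:
  fixes F :: "_ \<Rightarrow> complex"
  assumes "F \<in> borel_measurable (goe n)" "\<And>a. norm (F a) \<le> B"
  shows "integrable (goe n) F"
proof -
  interpret prob_space "goe n" by (rule prob_space_goe)
  show ?thesis by (rule integrable_const_bound[of _ B]) (use assms in auto)
qed

text \<open>A Gaussian coordinate is unbounded but has a finite first moment, so \<open>B\<close>
  times the coordinate dominates.\<close>

lemma integrable_goe_component_mult:
  fixes F :: "_ \<Rightarrow> complex"
  assumes p: "p \<in> goe_idx n" and F: "F \<in> borel_measurable (goe n)" "\<And>a. norm (F a) \<le> B"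
  shows "integrable (goe n) (\<lambda>a. a p *\<^sub>R F a)"
proof (rule Bochner_Integration.integrable_bound)
  show "integrable (goe n) (\<lambda>a. B * a p)" using integrable_goe_component[OF p] by simp
  have "B \<ge> 0" using F(2)[of undefined] norm_ge_zero order_trans by blast
  then show "AE a in goe n. norm (a p *\<^sub>R F a) \<le> norm (B * a p)"
    using F(2) by (auto intro!: AE_I2 simp: abs_mult mult.commute[of B] intro: mult_left_mono)
  show "(\<lambda>a. a p *\<^sub>R F a) \<in> borel_measurable (goe n)"
    using measurable_goe_component[OF p] F(1) by measurable
qed

text \<open>Fubini isolates the coordinate \<open>p\<close>; with the others frozen, the
  one-dimensional formula applies to the inner integral, and Fubini again restores the full
  expectation.\<close>

lemma goe_ibp:
  fixes F F' :: "(nat \<times> nat \<Rightarrow> real) \<Rightarrow> complex"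
  assumes p: "p \<in> goe_idx n"
    and meas: "F \<in> borel_measurable (goe n)" "F' \<in> borel_measurable (goe n)"
    and bd: "\<And>a. norm (F a) \<le> B" "\<And>a. norm (F' a) \<le> B'"
    and der: "\<And>a t. ((\<lambda>t. F (a(p := t))) has_vector_derivative F' (a(p := t))) (at t)"
    and cont: "\<And>a t. isCont (\<lambda>t. F' (a(p := t))) t"
  shows "(LINT a|goe n. a p *\<^sub>R F a) = (goe_sd p)\<^sup>2 *\<^sub>R (LINT a|goe n. F' a)"
proof -
  let ?I = "goe_idx n - {p}"
  have I: "finite ?I" "p \<notin> ?I" and ins: "insert p ?I = goe_idx n" using p finite_goe_idx by auto
  have "(LINT a|goe n. a p *\<^sub>R F a) =
      (LINT x|PiM ?I goe_marginal. LINT y|goe_marginal p. (x(p := y)) p *\<^sub>R F (x(p := y)))"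
    unfolding goe_eq_PiM
    by (rule goe_product.product_integral_insert[OF I, unfolded ins])
      (use integrable_goe_component_mult[OF p meas(1) bd(1)] in \<open>simp add: goe_eq_PiM\<close>)
  also have "\<dots> = (LINT x|PiM ?I goe_marginal. (goe_sd p)\<^sup>2 *\<^sub>R (LINT y|goe_marginal p. F' (x(p := y))))"
  proof (rule Bochner_Integration.integral_cong[OF refl])
    fix x
    show "(LINT y|goe_marginal p. (x(p := y)) p *\<^sub>R F (x(p := y))) =
      (goe_sd p)\<^sup>2 *\<^sub>R (LINT y|goe_marginal p. F' (x(p := y)))"
      using gaussian_ibp[OF goe_sd_pos[of p] der[where a = x] cont[where a = x] bd] by (simp add: goe_marginal_def)
  qed
  also have "\<dots> = (goe_sd p)\<^sup>2 *\<^sub>R (LINT a|goe n. F' a)"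
    unfolding goe_eq_PiM integral_scaleR_right
    by (subst goe_product.product_integral_insert[OF I, unfolded ins])
      (use integrable_goe_bounded[OF meas(2) bd(2)] in \<open>simp_all add: goe_eq_PiM\<close>)
  finally show ?thesis .
qed


subsection \<open>Resolvent entries along a coordinate line\<close>

text \<open>Caratheodory's form of differentiability: the difference quotient at \<open>s\<close> is
  \<open>g t\<close>, so its limit is \<open>g s\<close> by continuity. The resolvent identity
  produces exactly such a factorisation.\<close>

lemma has_vector_derivative_caratheodory:
  fixes f g :: "real \<Rightarrow> 'a::real_normed_vector"
  assumes eq: "\<And>t. f t - f s = (t - s) *\<^sub>R g t" and cont: "isCont g s"
  shows "(f has_vector_derivative g s) (at s)"
  unfolding has_vector_derivative_def has_derivative_iff_norm
proof
  show "bounded_linear (\<lambda>x. x *\<^sub>R g s)" by (rule bounded_linear_scaleR_left)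
  have "((\<lambda>t. norm (g t - g s)) \<longlongrightarrow> 0) (at s)"
    using cont by (simp add: isCont_def tendsto_norm_zero_iff LIM_zero_iff)
  moreover have "\<forall>\<^sub>F t in at s. norm (g t - g s) = norm (f t - f s - (t - s) *\<^sub>R g s) / norm (t - s)"
    unfolding eventually_at_filter
    by (rule always_eventually) (simp add: eq flip: scaleR_diff_right)
  ultimately show "((\<lambda>t. norm (f t - f s - (t - s) *\<^sub>R g s) / norm (t - s)) \<longlongrightarrow> 0) (at s)"
    by (rule Lim_transform_eventually)
qed

section \<open>Matrix preliminaries\<close>

text \<open>By the Leibniz formula the determinant is a polynomial in the entries.\<close>

lemma borel_measurable_det:
  fixes A :: "'a \<Rightarrow> complex mat"
  assumes "\<And>a. A a \<in> carrier_mat m m"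
    and "\<And>i j. i < m \<Longrightarrow> j < m \<Longrightarrow> (\<lambda>a. A a $$ (i, j)) \<in> borel_measurable M"
  shows "(\<lambda>a. det (A a)) \<in> borel_measurable M"
  unfolding det_def'[OF assms(1)]
  by (intro borel_measurable_sum borel_measurable_times borel_measurable_prod borel_measurable_const assms(2))
    (auto simp: permutes_in_image)

lemma index_mult_mat_sum:
  fixes A B :: "'a::semiring_0 mat"
  assumes "A \<in> carrier_mat n n" "B \<in> carrier_mat n n" "i < n" "j < n"
  shows "(A * B) $$ (i, j) = (\<Sum>k<n. A $$ (i, k) * B $$ (k, j))"
  using assms by (auto simp: scalar_prod_def atLeast0LessThan intro!: sum.cong)

text \<open>Transposing \<open>A G = 1\<close> shows that the transpose of \<open>G\<close> is a
  left inverse of \<open>A\<close>, and a left inverse coincides with a right inverse.\<close>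

lemma mat_symmetric_inverse:
  fixes A G :: "'a::comm_ring_1 mat"
  assumes A: "A \<in> carrier_mat n n" and G: "G \<in> carrier_mat n n"
    and sym: "transpose_mat A = A" and inv: "A * G = 1\<^sub>m n"
  shows "transpose_mat G = G"
proof -
  have "transpose_mat G * A = 1\<^sub>m n"
    using transpose_mult[OF A G] by (simp add: sym inv)
  then have "G = transpose_mat G * A * G" using G by simp
  also have "\<dots> = transpose_mat G * (A * G)"
    by (rule assoc_mult_mat) (use A G in auto)
  finally show ?thesis using G by (simp add: inv)
qed

locale goe_resolvent =
  fixes n :: nat and z :: complex
  assumes n_pos: "n > 0" and Im_z: "Im z \<noteq> 0"
begin

section \<open>The shifted matrix and its invertibility\<close>

definition w :: complex where "w = 2 + z * complex_of_real (real n powr (-2/3))"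

definition entry :: "(nat \<times> nat \<Rightarrow> real) \<Rightarrow> nat \<Rightarrow> nat \<Rightarrow> complex" where
  "entry a i j = complex_of_real (a (min i j, max i j) / sqrt (real n))"

definition shifted :: "(nat \<times> nat \<Rightarrow> real) \<Rightarrow> complex mat" where
  "shifted a = goe_mat n a - w \<cdot>\<^sub>m 1\<^sub>m n"

text \<open>Powers of the resolvent are treated entry by entry, so that the calculus below concerns
  scalar functions of \<open>a\<close>.\<close>

definition P :: "nat \<Rightarrow> nat \<Rightarrow> nat \<Rightarrow> (nat \<times> nat \<Rightarrow> real) \<Rightarrow> complex" where
  "P k i j a = (resolv n z a ^\<^sub>m k) $$ (i, j)"

definition G :: "nat \<Rightarrow> nat \<Rightarrow> (nat \<times> nat \<Rightarrow> real) \<Rightarrow> complex" where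
  "G i j a = resolv n z a $$ (i, j)"

definition bound :: real where "bound = 1 / \<bar>Im w\<bar>"

lemma Im_w: "Im w \<noteq> 0"
  using n_pos Im_z by (simp add: w_def)

lemma bound_pos: "bound > 0"
  using Im_w by (simp add: bound_def)

lemma shifted_carrier [simp]: "shifted a \<in> carrier_mat n n"
  by (simp add: shifted_def goe_mat_def minus_carrier_mat)

lemma shifted_index:
  "i < n \<Longrightarrow> j < n \<Longrightarrow> shifted a $$ (i, j) = entry a i j - (if i = j then w else 0)"
  by (simp add: shifted_def goe_mat_def entry_def)

lemma entry_commute: "entry a i j = entry a j i"
  by (simp add: entry_def min.commute max.commute)

lemma transpose_shifted: "transpose_mat (shifted a) = shifted a"
  by (rule eq_matI) (auto simp: shifted_index entry_commute carrier_matD[OF shifted_carrier])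

text \<open>The unshifted matrix is real symmetric and contributes a real number, so only
  \<open>- w\<close> reaches the imaginary part. Both invertibility and the bound on the resolvent
  rest on this.\<close>

lemma Im_quadratic_form:
  "Im (\<Sum>i<n. \<Sum>j<n. cnj (v i) * (shifted a $$ (i, j) * v j)) = - Im w * (\<Sum>i<n. (cmod (v i))\<^sup>2)"
proof -
  \<comment> \<open>\<open>S\<close> is the form without the shift; conjugating it merely exchanges
    the two summation indices.\<close>
  define S where "S = (\<Sum>i<n. \<Sum>j<n. cnj (v i) * (entry a i j * v j))"
  have "cnj S = (\<Sum>i<n. \<Sum>j<n. cnj (v j) * (entry a j i * v i))"
    unfolding S_def by (simp add: entry_def mult_ac min.commute max.commute)
  also have "\<dots> = S" unfolding S_def by (rule sum.swap)
  finally have "Im S = 0" by (simp add: complex_eq_iff)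
  moreover have "(\<Sum>i<n. \<Sum>j<n. cnj (v i) * (shifted a $$ (i, j) * v j)) = S - (\<Sum>i<n. w * of_real ((cmod (v i))\<^sup>2))"
    unfolding S_def sum_subtractf[symmetric]
  proof (rule sum.cong[OF refl])
    fix i assume i: "i \<in> {..<n}"
    have "(\<Sum>j<n. cnj (v i) * (shifted a $$ (i, j) * v j)) =
        (\<Sum>j<n. cnj (v i) * (entry a i j * v j) - (if i = j then cnj (v i) * w * v i else 0))"
      using i by (intro sum.cong) (auto simp: shifted_index algebra_simps)
    also have "\<dots> = (\<Sum>j<n. cnj (v i) * (entry a i j * v j)) - cnj (v i) * w * v i"
      using i by (simp add: sum_subtractf)
    also have "cnj (v i) * w * v i = w * of_real ((cmod (v i))\<^sup>2)"
      unfolding complex_norm_square by simp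
    finally show "(\<Sum>j<n. cnj (v i) * (shifted a $$ (i, j) * v j)) =
      (\<Sum>j<n. cnj (v i) * (entry a i j * v j)) - w * of_real ((cmod (v i))\<^sup>2)" .
  qed
  ultimately show ?thesis by (simp flip: of_real_power add: sum_distrib_left sum_negf)
qed

text \<open>A kernel vector makes the quadratic form vanish; since \<open>Im w\<close> is nonzero,
  its norm is zero.\<close>

lemma det_shifted: "det (shifted a) \<noteq> 0"
proof
  assume "det (shifted a) = 0"
  then obtain v where v: "v \<in> carrier_vec n" "v \<noteq> 0\<^sub>v n" and 0: "shifted a *\<^sub>v v = 0\<^sub>v n"
    using det_0_iff_vec_prod_zero[OF shifted_carrier] by blast
  have "(\<Sum>j<n. shifted a $$ (i, j) * vec_index v j) = 0" if "i < n" for i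
    using arg_cong[OF 0, of "\<lambda>u. vec_index u i"] that v carrier_matD[OF shifted_carrier[of a]]
    by (simp add: scalar_prod_def atLeast0LessThan)
  then have "(\<Sum>i<n. \<Sum>j<n. cnj (vec_index v i) * (shifted a $$ (i, j) * vec_index v j)) = 0"
    by (simp flip: sum_distrib_left)
  then have "(\<Sum>i<n. (cmod (vec_index v i))\<^sup>2) = 0"
    using Im_quadratic_form[of "\<lambda>i. vec_index v i" a] Im_w by simp
  then have "\<forall>i<n. vec_index v i = 0" by (subst (asm) sum_nonneg_eq_0_iff) auto
  with v show False by (auto intro: eq_vecI)
qed

text \<open>\<open>resolv\<close> extracts its value from an option, so \<open>None\<close> has to
  be excluded; the nonzero determinant does this.\<close>

lemma resolv_inverse:
  "resolv n z a \<in> carrier_mat n n" "shifted a * resolv n z a = 1\<^sub>m n" "resolv n z a * shifted a = 1\<^sub>m n"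
proof -
  have "shifted a \<in> Units (ring_mat TYPE(complex) n ())"
    by (rule det_non_zero_imp_unit[OF shifted_carrier det_shifted])
  then have "mat_inverse (shifted a) \<noteq> None"
    using mat_inverse(1)[OF shifted_carrier[of a], where b = "()"] by auto
  then obtain G where "mat_inverse (shifted a) = Some G" by auto
  moreover from this have "resolv n z a = G"
    by (simp add: resolv_def shifted_def w_def)
  ultimately show "resolv n z a \<in> carrier_mat n n" "shifted a * resolv n z a = 1\<^sub>m n"
    "resolv n z a * shifted a = 1\<^sub>m n"
    using mat_inverse(2)[OF shifted_carrier] by auto
qed

section \<open>Entries of resolvent powers: algebra and bounds\<close>

lemma P_0: "i < n \<Longrightarrow> j < n \<Longrightarrow> P 0 i j a = (if i = j then 1 else 0)"
  using resolv_inverse(1)[of a] by (simp add: P_def)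

lemma P_1 [simp]: "P (Suc 0) i j a = G i j a"
  using resolv_inverse(1)[of a] by (simp add: P_def G_def)

lemma P_add:
  assumes "i < n" "j < n"
  shows "P (k + l) i j a = (\<Sum>c<n. P k i c a * P l c j a)"
proof -
  have G: "resolv n z a \<in> carrier_mat n n" by (rule resolv_inverse)
  have "resolv n z a ^\<^sub>m (k + l) = resolv n z a ^\<^sub>m k * resolv n z a ^\<^sub>m l"
  proof (induction l)
    case (Suc l)
    show ?case
      using assoc_mult_mat[OF pow_carrier_mat[OF G, of k] pow_carrier_mat[OF G, of l] G] Suc by simp
  qed (use G in \<open>simp add: right_mult_one_mat[OF pow_carrier_mat[OF G, of k]]\<close>)
  then show ?thesis
    unfolding P_def using assms G by (simp add: index_mult_mat_sum pow_carrier_mat del: index_mult_mat)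
qed

lemma P_Suc:
  assumes "i < n" "j < n"
  shows "P (Suc k) i j a = (\<Sum>c<n. P k i c a * G c j a)"
    "P (Suc k) i j a = (\<Sum>c<n. G i c a * P k c j a)"
  using P_add[OF assms, of k 1] P_add[OF assms, of 1 k] by simp_all

lemma shifted_P:
  assumes "i < n" "j < n"
  shows "(\<Sum>k<n. shifted a $$ (i, k) * G k j a) = (if i = j then 1 else 0)"
    "(\<Sum>k<n. G i k a * shifted a $$ (k, j)) = (if i = j then 1 else 0)"
  using arg_cong[OF resolv_inverse(2)[of a], of "\<lambda>M. M $$ (i, j)"]
    arg_cong[OF resolv_inverse(3)[of a], of "\<lambda>M. M $$ (i, j)"]
  unfolding G_def index_mult_mat_sum[OF shifted_carrier resolv_inverse(1) assms]
    index_mult_mat_sum[OF resolv_inverse(1) shifted_carrier assms]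
  using assms by auto

lemma G_commute: "i < n \<Longrightarrow> j < n \<Longrightarrow> G i j a = G j i a"
  using arg_cong[OF mat_symmetric_inverse[OF shifted_carrier resolv_inverse(1) transpose_shifted resolv_inverse(2), of a],
      of "\<lambda>M. M $$ (j, i)"] resolv_inverse(1)[of a]
  by (simp add: G_def)

lemma P_commute: "i < n \<Longrightarrow> j < n \<Longrightarrow> P k i j a = P k j i a"
proof (induction k arbitrary: i j)
  case (Suc k)
  have "P (Suc k) i j a = (\<Sum>c<n. P k i c a * G c j a)"
    using P_Suc(1) Suc.prems by simp
  also have "\<dots> = (\<Sum>c<n. G j c a * P k c i a)"
    using Suc G_commute[of j] by (intro sum.cong) auto
  also have "\<dots> = P (Suc k) j i a" using P_Suc(2) Suc.prems by simp
  finally show ?case .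
qed (simp add: P_0)

text \<open>Let \<open>v\<close> be column \<open>j\<close> of the resolvent. Since
  \<open>shifted a\<close> maps \<open>v\<close> to the unit vector \<open>j\<close>, its quadratic
  form equals the conjugate of \<open>v j\<close>, whence \<open>|Im w|\<close> times the squared
  norm of \<open>v\<close> is at most \<open>|v j|\<close>.\<close>

lemma norm_G:
  assumes i: "i < n" and j: "j < n"
  shows "cmod (G i j a) \<le> bound"
proof -
  let ?v = "\<lambda>i. G i j a"
  have "(\<Sum>i<n. \<Sum>k<n. cnj (?v i) * (shifted a $$ (i, k) * ?v k)) = (\<Sum>i<n. cnj (?v i) * (if i = j then 1 else 0))"
    using shifted_P(1)[of _ j a] j by (intro sum.cong) (simp_all flip: sum_distrib_left)
  also have "\<dots> = cnj (?v j)" using j by (simp add: if_distrib cong: if_cong)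
  finally have "- Im w * (\<Sum>i<n. (cmod (?v i))\<^sup>2) = Im (cnj (?v j))"
    using Im_quadratic_form[of ?v a] by simp
  moreover have "\<bar>Im (cnj (?v j))\<bar> \<le> cmod (?v j)" using abs_Im_le_cmod[of "?v j"] by simp
  moreover have "\<bar>- Im w * (\<Sum>i<n. (cmod (?v i))\<^sup>2)\<bar> = \<bar>Im w\<bar> * (\<Sum>i<n. (cmod (?v i))\<^sup>2)"
    by (simp add: abs_mult sum_nonneg)
  ultimately have "\<bar>Im w\<bar> * (\<Sum>i<n. (cmod (?v i))\<^sup>2) \<le> cmod (?v j)" by argo
  then have *: "(\<Sum>i<n. (cmod (?v i))\<^sup>2) \<le> bound * cmod (?v j)"
    using Im_w by (simp add: bound_def field_simps)
  have le: "(cmod (?v i))\<^sup>2 \<le> bound * cmod (?v j)" if "i < n" for i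
    using member_le_sum[of i "{..<n}" "\<lambda>i. (cmod (?v i))\<^sup>2"] * that by fastforce
  \<comment> \<open>Component \<open>j\<close> is bounded first, from its own inequality; this then
    bounds the right-hand side for every other component.\<close>
  have "cmod (?v j) \<le> bound"
    using le[OF j] bound_pos by (cases "cmod (?v j) = 0") (auto simp: power2_eq_square)
  then have "(cmod (?v i))\<^sup>2 \<le> bound\<^sup>2"
    using order_trans[OF le[OF i] mult_left_mono] bound_pos by (simp add: power2_eq_square)
  then show ?thesis using power2_le_imp_le less_imp_le[OF bound_pos] by blast
qed

text \<open>The growth in \<open>n\<close> is harmless: the bound only serves integrability at fixed
  \<open>n\<close>.\<close>

lemma norm_P: "i < n \<Longrightarrow> j < n \<Longrightarrow> cmod (P k i j a) \<le> (n * bound) ^ k"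
proof (induction k arbitrary: j)
  case (Suc k)
  have "cmod (P (Suc k) i j a) \<le> (\<Sum>c<n. cmod (P k i c a) * cmod (G c j a))"
    using P_Suc(1) Suc.prems by (simp add: norm_mult sum_norm_le)
  also have "\<dots> \<le> (\<Sum>c<n. (n * bound) ^ k * bound)"
    using Suc bound_pos by (intro sum_mono mult_mono norm_G) auto
  finally show ?case by (simp add: mult_ac)
qed (simp add: P_0)

section \<open>Measurability of the resolvent\<close>

text \<open>Cramer's rule. It writes the entries as quotients of determinants, which makes their
  measurability accessible.\<close>

lemma G_cofactor:
  assumes "i < n" "j < n"
  shows "G i j a = cofactor (shifted a) j i / det (shifted a)"
proof -
  let ?A = "shifted a" and ?G = "resolv n z a"
  note G = resolv_inverse(1)[of a] and adj = adj_mat[OF shifted_carrier[of a]]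
  have "adj_mat ?A = ?G * ?A * adj_mat ?A" using adj(1) by (simp add: resolv_inverse)
  also have "\<dots> = ?G * (?A * adj_mat ?A)" by (rule assoc_mult_mat[OF G shifted_carrier adj(1)])
  also have "\<dots> = det ?A \<cdot>\<^sub>m ?G"
    using G by (simp add: adj(2) mult_smult_distrib[OF G one_carrier_mat])
  finally have "adj_mat ?A $$ (i, j) = det ?A * G i j a"
    using assms G by (simp add: G_def)
  then show ?thesis
    using assms det_shifted[of a] carrier_matD[OF shifted_carrier[of a]]
    by (simp add: adj_mat_def field_simps)
qed

lemma measurable_entry:
  assumes "i < n" "j < n"
  shows "(\<lambda>a. entry a i j) \<in> borel_measurable (goe n)"
proof -
  have "(min i j, max i j) \<in> goe_idx n" using assms by (auto simp: goe_idx_def)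
  from measurable_goe_component[OF this] show ?thesis unfolding entry_def by measurable
qed

lemma measurable_G:
  assumes ij: "i < n" "j < n"
  shows "G i j \<in> borel_measurable (goe n)"
proof -
  have sh: "(\<lambda>a. shifted a $$ (i, j)) \<in> borel_measurable (goe n)" if "i < n" "j < n" for i j
    unfolding shifted_index[OF that] using measurable_entry[OF that] by measurable
  have "(\<lambda>a. det (mat_delete (shifted a) j i)) \<in> borel_measurable (goe n)"
  proof (rule borel_measurable_det)
    show "mat_delete (shifted a) j i \<in> carrier_mat (n - 1) (n - 1)" for a
      by (rule mat_delete_carrier[OF shifted_carrier])
    show "(\<lambda>a. mat_delete (shifted a) j i $$ (i', j')) \<in> borel_measurable (goe n)"
      if "i' < n - 1" "j' < n - 1" for i' j'
      using that unfolding mat_delete_def by (auto simp: carrier_matD[OF shifted_carrier] intro!: sh)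
  qed
  moreover have "(\<lambda>a. det (shifted a)) \<in> borel_measurable (goe n)"
    by (rule borel_measurable_det[OF shifted_carrier sh])
  ultimately have "(\<lambda>a. cofactor (shifted a) j i / det (shifted a)) \<in> borel_measurable (goe n)"
    unfolding cofactor_def by measurable
  then show ?thesis using G_cofactor[OF ij] by presburger
qed

lemma measurable_P: "i < n \<Longrightarrow> j < n \<Longrightarrow> P k i j \<in> borel_measurable (goe n)"
proof (induction k arbitrary: j)
  case 0
  then show ?case by (simp add: P_0 cong: measurable_cong)
next
  case (Suc k)
  have "P (Suc k) i j = (\<lambda>a. \<Sum>c<n. P k i c a * G c j a)"
    using P_Suc(1) Suc.prems by auto
  then show ?case using Suc measurable_G by (auto intro!: borel_measurable_sum borel_measurable_times)
qed

text \<open>The weight compensates for the two entries of the matrix moved by an off-diagonal parameter.\<close>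
definition weight :: "nat \<times> nat \<Rightarrow> real" where
  "weight p = (if fst p = snd p then 1/2 else 1) / sqrt (real n)"

section \<open>Differentiating the resolvent in one matrix parameter\<close>

text \<open>The shift \<open>w\<close> cancels in the difference of entries, so \<open>entry\<close>
  may be replaced by \<open>shifted\<close>; each of the two products then collapses, one against
  each resolvent.\<close>

lemma resolvent_identity:
  assumes "i < n" "j < n"
  shows "G i j a - G i j b = (\<Sum>k<n. \<Sum>l<n. G i k a * (entry b k l - entry a k l) * G l j b)"
proof -
  have "(\<Sum>k<n. \<Sum>l<n. G i k a * (entry b k l - entry a k l) * G l j b) =
      (\<Sum>k<n. G i k a * (\<Sum>l<n. shifted b $$ (k, l) * G l j b)) -
      (\<Sum>k<n. \<Sum>l<n. G i k a * shifted a $$ (k, l) * G l j b)"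
    unfolding sum_distrib_left sum_subtractf[symmetric]
    by (intro sum.cong refl) (auto simp: shifted_index algebra_simps)
  also have "(\<Sum>k<n. \<Sum>l<n. G i k a * shifted a $$ (k, l) * G l j b) =
      (\<Sum>l<n. (\<Sum>k<n. G i k a * shifted a $$ (k, l)) * G l j b)"
    by (subst sum.swap) (simp add: sum_distrib_right)
  also have "\<dots> = (\<Sum>l<n. (if i = l then 1 else 0) * G l j b)"
    using assms by (intro sum.cong) (simp_all add: shifted_P)
  also have "(\<Sum>k<n. G i k a * (\<Sum>l<n. shifted b $$ (k, l) * G l j b)) =
      (\<Sum>k<n. G i k a * (if k = j then 1 else 0))"
    using assms by (intro sum.cong) (simp_all add: shifted_P)
  finally show ?thesis using assms by (simp add: if_distrib[of "\<lambda>x. _ * x"] if_distrib[of "\<lambda>x. x * _"] cong: if_cong)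
qed

text \<open>The parameter \<open>(p, q)\<close> moves only the entries \<open>(p, q)\<close> and
  \<open>(q, p)\<close>, so two terms of the resolvent identity survive. On the diagonal they are
  the same entry, counted twice with half the weight.\<close>

lemma G_line:
  assumes p: "(p, q) \<in> goe_idx n" and ij: "i < n" "j < n"
  shows "G i j (a((p, q) := t)) - G i j (a((p, q) := s)) = (t - s) *\<^sub>R
    (- complex_of_real (weight (p, q)) *
      (G i p (a((p, q) := t)) * G q j (a((p, q) := s)) + G i q (a((p, q) := t)) * G p j (a((p, q) := s))))"
proof -
  let ?a = "\<lambda>t. a((p, q) := t)"
  let ?c = "complex_of_real ((s - t) / sqrt (real n))"
  have pq: "p \<le> q" "q < n" "p < n" using p by (auto simp: goe_idx_def)
  have e: "entry (?a s) k l - entry (?a t) k l =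
      (if k = p \<and> l = q then ?c else 0) + (if p \<noteq> q \<and> k = q \<and> l = p then ?c else 0)" for k l
    using pq by (auto simp: entry_def min_def max_def diff_divide_distrib)
  have "G i j (?a t) - G i j (?a s) =
    (\<Sum>k<n. \<Sum>l<n. (if k = p then if l = q then G i k (?a t) * ?c * G l j (?a s) else 0 else 0) +
       (if k = q then if l = p then if p \<noteq> q then G i k (?a t) * ?c * G l j (?a s) else 0 else 0 else 0))"
    unfolding resolvent_identity[OF ij] e by (intro sum.cong refl) (auto simp: algebra_simps)
  also have "\<dots> = G i p (?a t) * ?c * G q j (?a s) + (if p \<noteq> q then G i q (?a t) * ?c * G p j (?a s) else 0)"
    using pq by (simp add: sum.distrib if_distrib[of "\<lambda>f. sum f _"] sum.If_cases)
  also have "\<dots> = (t - s) *\<^sub>R (- complex_of_real (weight (p, q)) *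
      (G i p (?a t) * G q j (?a s) + G i q (?a t) * G p j (?a s)))"
  proof -
    define u r where "u = complex_of_real (t - s)" and "r = complex_of_real (1 / sqrt (real n))"
    have "?c = - (u * r)"
      by (simp add: u_def r_def diff_divide_distrib)
    moreover have "complex_of_real (weight (p, q)) = (if p = q then r / 2 else r)"
      by (simp add: weight_def r_def)
    ultimately show ?thesis
      unfolding scaleR_conv_of_real u_def[symmetric] by (cases "p = q") (simp_all add: algebra_simps)
  qed
  finally show ?thesis .
qed

text \<open>\<open>G_line\<close> and the uniform bound on entries make the resolvent Lipschitz
  along the line.\<close>

lemma isCont_G:
  assumes p: "(p, q) \<in> goe_idx n" and ij: "i < n" "j < n"
  shows "isCont (\<lambda>t. G i j (a((p, q) := t))) s"
proof -
  let ?a = "\<lambda>t. a((p, q) := t)"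
  have pq: "q < n" "p < n" using p by (auto simp: goe_idx_def)
  let ?C = "\<bar>weight (p, q)\<bar> * (bound * bound + bound * bound)"
  have "((\<lambda>t. G i j (?a t) - G i j (?a s)) \<longlongrightarrow> 0) (at s)"
  proof (rule Lim_null_comparison)
    have "norm (G i j (?a t) - G i j (?a s)) \<le> \<bar>t - s\<bar> * ?C" for t
      unfolding G_line[OF p ij] norm_scaleR norm_mult norm_minus_cancel norm_of_real real_norm_def
      using ij pq bound_pos
      by (intro mult_left_mono order_trans[OF norm_triangle_ineq] add_mono)
        (auto simp: norm_mult intro!: mult_mono norm_G)
    then show "\<forall>\<^sub>F t in at s. norm (G i j (?a t) - G i j (?a s)) \<le> \<bar>t - s\<bar> * ?C" by simp
    show "((\<lambda>t. \<bar>t - s\<bar> * ?C) \<longlongrightarrow> 0) (at s)"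
      by (rule tendsto_eq_intros refl | simp)+
  qed
  then show ?thesis by (simp add: isCont_def LIM_zero_iff)
qed

lemma has_vector_derivative_G:
  assumes p: "(p, q) \<in> goe_idx n" and ij: "i < n" "j < n"
  shows "((\<lambda>t. G i j (a((p, q) := t))) has_vector_derivative
    - complex_of_real (weight (p, q)) *
      (G i p (a((p, q) := t)) * G q j (a((p, q) := t)) + G i q (a((p, q) := t)) * G p j (a((p, q) := t)))) (at t)"
proof -
  have pq: "q < n" "p < n" using p by (auto simp: goe_idx_def)
  show ?thesis
    by (rule has_vector_derivative_caratheodory[OF G_line[OF p ij]])
      (intro continuous_intros isCont_G p ij pq)
qed

text \<open>This is \<open>d(G^k) = - sum over r < k of G^(r+1) dA G^(k-r)\<close>, where the
  symmetric perturbation \<open>dA\<close> gives two terms for each \<open>r\<close>. The induction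
  applies the product rule to \<open>G^k G\<close>.\<close>

lemma has_vector_derivative_P:
  assumes p: "(p, q) \<in> goe_idx n" and i: "i < n"
  shows "j < n \<Longrightarrow> ((\<lambda>t. P k i j (a((p, q) := t))) has_vector_derivative
    - complex_of_real (weight (p, q)) *
      (\<Sum>r<k. P (Suc r) i p (a((p, q) := t)) * P (k - r) q j (a((p, q) := t)) +
             P (Suc r) i q (a((p, q) := t)) * P (k - r) p j (a((p, q) := t)))) (at t)"
proof (induction k arbitrary: j)
  case 0
  then show ?case using i by (simp add: P_0)
next
  case (Suc k)
  let ?a = "a((p, q) := t)"
  let ?w = "complex_of_real (weight (p, q))"
  have pq: "q < n" "p < n" using p by (auto simp: goe_idx_def)
  have S: "P (Suc k) i j b = (\<Sum>c<n. P k i c b * G c j b)" for b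
    using P_Suc(1) i Suc.prems by simp
  define D where "D c = (\<Sum>r<k. P (Suc r) i p ?a * P (k - r) q c ?a + P (Suc r) i q ?a * P (k - r) p c ?a)" for c
  have "((\<lambda>t. P (Suc k) i j (a((p, q) := t))) has_vector_derivative
     (\<Sum>c<n. P k i c ?a * (- ?w * (G c p ?a * G q j ?a + G c q ?a * G p j ?a)) + (- ?w * D c) * G c j ?a)) (at t)"
    unfolding S D_def
    by (intro has_vector_derivative_sum has_vector_derivative_mult has_vector_derivative_G Suc.IH p Suc.prems) auto
  also have "(\<Sum>c<n. P k i c ?a * (- ?w * (G c p ?a * G q j ?a + G c q ?a * G p j ?a)) + (- ?w * D c) * G c j ?a) =
     (\<Sum>c<n. - ?w * (P k i c ?a * G c p ?a * G q j ?a + P k i c ?a * G c q ?a * G p j ?a + D c * G c j ?a))"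
    by (intro sum.cong refl) (simp add: algebra_simps)
  also have "\<dots> = - ?w * ((\<Sum>c<n. P k i c ?a * G c p ?a) * G q j ?a + (\<Sum>c<n. P k i c ?a * G c q ?a) * G p j ?a + (\<Sum>c<n. D c * G c j ?a))"
    by (simp only: sum.distrib sum_distrib_left[symmetric] sum_distrib_right[symmetric])
  \<comment> \<open>Multiplication by the last factor \<open>G\<close> raises the right-hand power
    in every old term; the term \<open>r = k\<close> comes from differentiating that factor.\<close>
  also have "(\<Sum>c<n. D c * G c j ?a) =
     (\<Sum>r<k. \<Sum>c<n. (P (Suc r) i p ?a * P (k - r) q c ?a + P (Suc r) i q ?a * P (k - r) p c ?a) * G c j ?a)"
    unfolding D_def sum_distrib_right by (rule sum.swap)
  also have "\<dots> = (\<Sum>r<k. P (Suc r) i p ?a * (\<Sum>c<n. P (k - r) q c ?a * G c j ?a) + P (Suc r) i q ?a * (\<Sum>c<n. P (k - r) p c ?a * G c j ?a))"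
    by (simp only: distrib_right mult.assoc sum.distrib sum_distrib_left)
  also have "\<dots> = (\<Sum>r<k. P (Suc r) i p ?a * P (Suc k - r) q j ?a + P (Suc r) i q ?a * P (Suc k - r) p j ?a)"
    using pq Suc.prems by (intro sum.cong) (auto simp: Suc_diff_le P_Suc(1))
  finally show ?case
    by (simp add: add_ac P_Suc(1)[OF i pq(1), symmetric] P_Suc(1)[OF i pq(2), symmetric] del: fun_upd_apply)
qed

lemma isCont_P:
  assumes "p \<in> goe_idx n" "i < n" "j < n"
  shows "isCont (\<lambda>t. P k i j (a(p := t))) t"
  using has_vector_derivative_continuous[OF has_vector_derivative_P[of "fst p" "snd p" i j k a t]] assms
  by (simp del: fun_upd_apply)

end

subsection \<open>The loop equation\<close>

text \<open>The doubled variance on the diagonal cancels the halved weight, so all matrix entries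
  obey one common formula.\<close>

lemma goe_sd_weight: "(goe_sd p)\<^sup>2 * ((if fst p = snd p then 1/2 else 1) / c) = 1 / c"
  by (simp add: goe_sd_def)

lemma mcomp_map_upt: "mcomp (map f [1..<m + 1]) i = (if 1 \<le> i \<and> i \<le> m then f i else 0)"
  by (auto simp: mcomp_def simp del: upt_Suc)

lemma mcomp_madd: "mcomp (madd K L) i = mcomp K i + mcomp L i"
  unfolding madd_def mcomp_map_upt by (auto simp: mcomp_def le_max_iff_disj)

lemma mcomp_msub: "mcomp (msub K L) i = mcomp K i - mcomp L i"
  unfolding msub_def mcomp_map_upt by (auto simp: mcomp_def le_max_iff_disj)

lemma mcomp_unit_mi: "l \<ge> 1 \<Longrightarrow> mcomp (unit_mi l) i = (if i = l then 1 else 0)"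
  by (auto simp: mcomp_def unit_mi_def nth_append)

lemma length_madd: "length (madd K L) = max (length K) (length L)"
  by (simp add: madd_def del: upt_Suc)

lemma length_msub: "length (msub K L) = max (length K) (length L)"
  by (simp add: msub_def del: upt_Suc)

lemma length_unit_mi: "l \<ge> 1 \<Longrightarrow> length (unit_mi l) = l"
  by (simp add: unit_mi_def)

context goe_resolvent
begin

section \<open>Functionals admitting integration by parts\<close>

text \<open>A class closed under sums and products and containing all entries of resolvent powers.
  The derivatives that occur are again polynomials in such entries, so the analytic side conditions
  follow from \<open>regular_intros\<close>.\<close>

definition regular :: "((nat \<times> nat \<Rightarrow> real) \<Rightarrow> complex) \<Rightarrow> bool" where
  "regular F \<longleftrightarrow> F \<in> borel_measurable (goe n) \<and> (\<exists>B. \<forall>a. cmod (F a) \<le> B) \<and>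
    (\<forall>p\<in>goe_idx n. \<forall>a t. isCont (\<lambda>t. F (a(p := t))) t)"

named_theorems regular_intros

lemma regular_const [regular_intros]: "regular (\<lambda>a. c)"
  by (auto simp: regular_def)

lemma regular_P [regular_intros]: "i < n \<Longrightarrow> j < n \<Longrightarrow> regular (\<lambda>a. P k i j a)"
  unfolding regular_def using measurable_P norm_P isCont_P by blast

lemma regular_G [regular_intros]: "i < n \<Longrightarrow> j < n \<Longrightarrow> regular (\<lambda>a. G i j a)"
  using regular_P[of i j "Suc 0"] by simp

lemma regular_add [regular_intros]:
  assumes "regular F" "regular H"
  shows "regular (\<lambda>a. F a + H a)"
proof -
  from assms obtain B C where "\<And>a. cmod (F a) \<le> B" "\<And>a. cmod (H a) \<le> C"
    unfolding regular_def by blast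
  then have "cmod (F a + H a) \<le> B + C" for a
    by (intro order_trans[OF norm_triangle_ineq] add_mono)
  with assms show ?thesis
    unfolding regular_def by (auto intro!: isCont_add borel_measurable_add)
qed

lemma regular_mult [regular_intros]:
  assumes "regular F" "regular H"
  shows "regular (\<lambda>a. F a * H a)"
proof -
  from assms obtain B C where BC: "\<And>a. cmod (F a) \<le> B" "\<And>a. cmod (H a) \<le> C"
    unfolding regular_def by blast
  then have "cmod (F a * H a) \<le> B * C" for a
    using order_trans[OF norm_ge_zero BC(1)] by (auto simp: norm_mult intro!: mult_mono)
  with assms show ?thesis
    unfolding regular_def by (auto intro!: isCont_mult borel_measurable_times)
qed

lemma regular_sum [regular_intros]:
  "(\<And>x. x \<in> A \<Longrightarrow> regular (\<lambda>a. F x a)) \<Longrightarrow> regular (\<lambda>a. \<Sum>x\<in>A. F x a)"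
  by (induction A rule: infinite_finite_induct) (auto intro: regular_intros)

lemma regular_prod [regular_intros]:
  "(\<And>x. x \<in> A \<Longrightarrow> regular (\<lambda>a. F x a)) \<Longrightarrow> regular (\<lambda>a. \<Prod>x\<in>A. F x a)"
  by (induction A rule: infinite_finite_induct) (auto intro: regular_intros)

lemma regular_power [regular_intros]: "regular F \<Longrightarrow> regular (\<lambda>a. F a ^ k)"
  by (induction k) (auto intro: regular_intros)

lemma integrable_regular: "regular F \<Longrightarrow> integrable (goe n) F"
  unfolding regular_def using integrable_goe_bounded by blast

lemma integrable_entry_regular:
  assumes "i < n" "j < n" "regular F"
  shows "integrable (goe n) (\<lambda>a. entry a i j * F a)"
proof -
  have p: "(min i j, max i j) \<in> goe_idx n" using assms by (auto simp: goe_idx_def)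
  obtain B where "F \<in> borel_measurable (goe n)" "\<And>a. cmod (F a) \<le> B"
    using assms(3) unfolding regular_def by blast
  then have "integrable (goe n) (\<lambda>a. (1 / sqrt n) *\<^sub>R (a (min i j, max i j) *\<^sub>R F a))"
    by (intro integrable_scaleR_right integrable_goe_component_mult[OF p])
  then show ?thesis by (simp add: entry_def scaleR_conv_of_real)
qed

text \<open>Variance times weight is \<open>1 / sqrt n\<close>, and the normalisation of the entry
  contributes another \<open>1 / sqrt n\<close>; no distinction between diagonal and off-diagonal
  entries remains.\<close>

lemma entry_ibp:
  assumes ij: "i < n" "j < n" and reg: "regular F" "regular F'"
    and der: "\<And>a t. ((\<lambda>t. F (a((min i j, max i j) := t))) has_vector_derivative
      - complex_of_real (weight (min i j, max i j)) * F' (a((min i j, max i j) := t))) (at t)"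
  shows "(LINT a|goe n. entry a i j * F a) = - (1 / of_nat n) * (LINT a|goe n. F' a)"
proof -
  define p where "p = (min i j, max i j)"
  have p: "p \<in> goe_idx n" using ij by (auto simp: p_def goe_idx_def)
  let ?F' = "\<lambda>a. - complex_of_real (weight p) * F' a"
  have "regular ?F'" by (intro regular_intros reg)
  with reg(1) obtain B B' where B: "\<And>a. cmod (F a) \<le> B" "\<And>a. cmod (?F' a) \<le> B'"
    unfolding regular_def by blast
  have "(LINT a|goe n. a p *\<^sub>R F a) = (goe_sd p)\<^sup>2 *\<^sub>R (LINT a|goe n. ?F' a)"
    by (rule goe_ibp[OF p _ _ B])
      (use reg(1) \<open>regular ?F'\<close> p der in \<open>auto simp: regular_def p_def simp del: fun_upd_apply\<close>)
  also have "\<dots> = - complex_of_real ((goe_sd p)\<^sup>2 * weight p) * (LINT a|goe n. F' a)"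
    by (simp add: scaleR_conv_of_real)
  also have "(goe_sd p)\<^sup>2 * weight p = 1 / sqrt n"
    unfolding weight_def by (rule goe_sd_weight)
  finally have *: "(LINT a|goe n. a p *\<^sub>R F a) = - complex_of_real (1 / sqrt n) * (LINT a|goe n. F' a)" .
  have "(LINT a|goe n. entry a i j * F a) = (LINT a|goe n. (1 / sqrt n) *\<^sub>R (a p *\<^sub>R F a))"
    by (simp add: entry_def p_def scaleR_conv_of_real)
  also have "\<dots> = - complex_of_real (1 / sqrt n * (1 / sqrt n)) * (LINT a|goe n. F' a)"
    unfolding integral_scaleR_right * by (simp only: scaleR_conv_of_real of_real_mult mult_minus_left mult_minus_right mult.assoc)
  also have "1 / sqrt n * (1 / sqrt n) = 1 / real n" by simp
  finally show ?thesis by simp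
qed

section \<open>Traces, their monomials and derivatives\<close>

definition T :: "nat \<Rightarrow> (nat \<times> nat \<Rightarrow> real) \<Rightarrow> complex" where
  "T k a = (\<Sum>i<n. P k i i a)"

definition scale :: "nat \<Rightarrow> complex" where
  "scale l = complex_of_real (real n powr (- 2 * real l / 3))"

text \<open>\<open>h 1\<close> is the centred trace, so that the product in \<^const>\<open>mK\<close> becomes uniform in the index.\<close>
definition h :: "nat \<Rightarrow> (nat \<times> nat \<Rightarrow> real) \<Rightarrow> complex" where
  "h l a = (if l = 1 then gc1 n z a else gnk n l z a)"

text \<open>An exponent function with a cutoff \<open>M\<close> replaces the list, so that
  multi-indices of different lengths can be compared at a common cutoff.\<close>

definition Phi :: "(nat \<Rightarrow> nat) \<Rightarrow> nat \<Rightarrow> (nat \<times> nat \<Rightarrow> real) \<Rightarrow> complex" where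
  "Phi f M a = (\<Prod>l\<in>{1..M}. h l a ^ f l)"

text \<open>The monomial with one factor \<open>h l\<close> removed. The truncated subtraction at
  \<open>f l = 0\<close> does no harm, as the coefficient \<open>f l\<close> always accompanies
  it.\<close>

definition Phi_dec :: "(nat \<Rightarrow> nat) \<Rightarrow> nat \<Rightarrow> nat \<Rightarrow> (nat \<times> nat \<Rightarrow> real) \<Rightarrow> complex" where
  "Phi_dec f M l a = h l a ^ (f l - 1) * (\<Prod>j\<in>{1..M} - {l}. h j a ^ f j)"

lemma h_eq: "h l a = scale l * ((if l = 1 then of_nat n else 0) + T l a)"
proof -
  have d: "dim_row (resolv n z a) = n" using resolv_inverse(1)[of a] by simp
  have "mat_trace (resolv n z a) = T 1 a" by (simp add: mat_trace_def T_def d G_def)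
  moreover have "mat_trace (resolv n z a ^\<^sub>m l) = T l a"
    by (simp add: mat_trace_def T_def d P_def)
  ultimately show ?thesis by (simp add: h_def gc1_def gnk_def scale_def)
qed

lemma regular_T [regular_intros]: "regular (\<lambda>a. T k a)"
  unfolding T_def by (intro regular_intros) auto

lemma regular_h [regular_intros]: "regular (\<lambda>a. h l a)"
  unfolding h_eq by (intro regular_intros)

lemma regular_Phi [regular_intros]: "regular (\<lambda>a. Phi f M a)"
  unfolding Phi_def by (intro regular_intros)

lemma regular_Phi_dec [regular_intros]: "regular (\<lambda>a. Phi_dec f M l a)"
  unfolding Phi_dec_def by (intro regular_intros)

text \<open>By cyclicity of the trace each of the \<open>k\<close> terms collapses to an entry of
  \<open>G^(k+1)\<close>, and symmetry of that power identifies the entries \<open>(p, q)\<close>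
  and \<open>(q, p)\<close>.\<close>

lemma has_vector_derivative_T:
  assumes p: "(p, q) \<in> goe_idx n"
  shows "((\<lambda>t. T k (a((p, q) := t))) has_vector_derivative
    - complex_of_real (weight (p, q)) * (2 * of_nat k * P (Suc k) p q (a((p, q) := t)))) (at t)"
proof -
  let ?a = "a((p, q) := t)"
  let ?w = "complex_of_real (weight (p, q))"
  have pq: "q < n" "p < n" using p by (auto simp: goe_idx_def)
  have loop: "(\<Sum>i<n. P (Suc r) i u ?a * P (k - r) v i ?a) = P (Suc k) p q ?a"
    if "r < k" "(u, v) = (p, q) \<or> (u, v) = (q, p)" for r u v
  proof -
    have "(\<Sum>i<n. P (Suc r) i u ?a * P (k - r) v i ?a) = P ((k - r) + Suc r) v u ?a"
      using that pq by (subst P_add) (auto simp: mult.commute)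
    then show ?thesis using that pq P_commute[of p q] by auto
  qed
  have "((\<lambda>t. T k (a((p, q) := t))) has_vector_derivative
     (\<Sum>i<n. - ?w * (\<Sum>r<k. P (Suc r) i p ?a * P (k - r) q i ?a + P (Suc r) i q ?a * P (k - r) p i ?a))) (at t)"
    unfolding T_def by (intro has_vector_derivative_sum has_vector_derivative_P p) auto
  also have "(\<Sum>i<n. - ?w * (\<Sum>r<k. P (Suc r) i p ?a * P (k - r) q i ?a + P (Suc r) i q ?a * P (k - r) p i ?a)) =
     - ?w * (\<Sum>r<k. (\<Sum>i<n. P (Suc r) i p ?a * P (k - r) q i ?a) + (\<Sum>i<n. P (Suc r) i q ?a * P (k - r) p i ?a))"
    unfolding sum_distrib_left[symmetric] by (subst sum.swap) (simp only: sum.distrib)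
  also have "\<dots> = - ?w * (\<Sum>r<k. P (Suc k) p q ?a + P (Suc k) p q ?a)"
    using loop by (intro arg_cong2[of _ _ _ _ "(*)"] refl sum.cong arg_cong2[of _ _ _ _ "(+)"]) auto
  also have "\<dots> = - ?w * (2 * of_nat k * P (Suc k) p q ?a)" by simp
  finally show ?thesis .
qed

lemma has_vector_derivative_Phi:
  assumes p: "(p, q) \<in> goe_idx n"
  shows "((\<lambda>t. Phi f M (a((p, q) := t))) has_vector_derivative
    - complex_of_real (weight (p, q)) * (\<Sum>l\<in>{1..M}. 2 * of_nat (l * f l) * scale l *
      P (Suc l) p q (a((p, q) := t)) * Phi_dec f M l (a((p, q) := t)))) (at t)"
proof -
  let ?a = "a((p, q) := t)"
  let ?w = "complex_of_real (weight (p, q))"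
  define D where "D l = scale l * (- ?w * (2 * of_nat l * P (Suc l) p q ?a))" for l
  have "((\<lambda>t. h l (a((p, q) := t))) has_vector_derivative scale l * (0 + - ?w * (2 * of_nat l * P (Suc l) p q ?a))) (at t)" for l
    unfolding h_eq
    by (intro has_vector_derivative_mult_right has_vector_derivative_add has_vector_derivative_const has_vector_derivative_T p)
  then have "((\<lambda>t. h l (a((p, q) := t))) has_derivative (\<lambda>x. x *\<^sub>R D l)) (at t)" for l
    by (simp add: D_def has_vector_derivative_def)
  then have "((\<lambda>t. Phi f M (a((p, q) := t))) has_derivative
    (\<lambda>y. \<Sum>l\<in>{1..M}. of_nat (f l) * (y *\<^sub>R D l) * h l ?a ^ (f l - 1) * (\<Prod>j\<in>{1..M} - {l}. h j ?a ^ f j))) (at t)"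
    unfolding Phi_def by (intro has_derivative_prod has_derivative_power)
  moreover have "(\<Sum>l\<in>{1..M}. of_nat (f l) * (y *\<^sub>R D l) * h l ?a ^ (f l - 1) * (\<Prod>j\<in>{1..M} - {l}. h j ?a ^ f j)) =
    y *\<^sub>R (- ?w * (\<Sum>l\<in>{1..M}. 2 * of_nat (l * f l) * scale l * P (Suc l) p q ?a * Phi_dec f M l ?a))" for y
    unfolding sum_distrib_left scaleR_sum_right
    by (intro sum.cong refl) (simp add: D_def Phi_dec_def scaleR_conv_of_real mult_ac)
  ultimately show ?thesis unfolding has_vector_derivative_def by simp
qed

text \<open>The trace of \<open>A G = 1 + w G\<close>.\<close>

lemma resolvent_trace_identity: "(\<Sum>i<n. \<Sum>j<n. entry a i j * G j i a) = of_nat n + w * T 1 a"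
proof -
  have "(\<Sum>j<n. entry a i j * G j i a) = 1 + w * G i i a" if "i < n" for i
  proof -
    have "1 = (\<Sum>j<n. shifted a $$ (i, j) * G j i a)"
      using shifted_P(1)[OF that that, of a] by simp
    also have "\<dots> = (\<Sum>j<n. entry a i j * G j i a - (if i = j then w * G j i a else 0))"
      using that by (intro sum.cong refl) (auto simp: shifted_index algebra_simps)
    also have "\<dots> = (\<Sum>j<n. entry a i j * G j i a) - w * G i i a"
      using that by (simp add: sum_subtractf)
    finally show ?thesis by (simp add: algebra_simps)
  qed
  then show ?thesis by (simp add: T_def sum.distrib sum_distrib_left)
qed

text \<open>Integration by parts is applied to each \<open>entry a i j\<close> against
  \<open>G j i a * Phi f M a\<close>. Differentiating the resolvent entry yields
  \<open>T 2 a\<close> and the square of \<open>T 1 a\<close>; differentiating the monomial yields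
  the sum over \<open>l\<close>.\<close>

lemma loop_equation_unscaled:
  "(LINT a|goe n. (of_nat n + w * T 1 a) * Phi f M a) =
    - (1 / of_nat n) * (LINT a|goe n. (T 2 a + (T 1 a)\<^sup>2) * Phi f M a +
      (\<Sum>l\<in>{1..M}. 2 * of_nat (l * f l) * scale l * T (l + 2) a * Phi_dec f M l a))"
proof -
  \<comment> \<open>\<open>H i j\<close> is the derivative of \<open>G j i a * Phi f M a\<close> in
    the parameter of entry \<open>(i, j)\<close>, with the factor \<open>- weight\<close>
    removed.\<close>
  define H where "H i j a = (G i j a * G j i a + G i i a * G j j a) * Phi f M a +
      (\<Sum>l\<in>{1..M}. 2 * of_nat (l * f l) * scale l * (P (Suc l) i j a * G j i a) * Phi_dec f M l a)" for i j a
  have reg: "regular (\<lambda>a. G j i a * Phi f M a)" "regular (H i j)" if "i < n" "j < n" for i j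
    unfolding H_def[abs_def] by (intro regular_intros that)+
  have ibp: "(LINT a|goe n. entry a i j * (G j i a * Phi f M a)) = - (1 / of_nat n) * (LINT a|goe n. H i j a)"
    if ij: "i < n" "j < n" for i j
  proof (rule entry_ibp[OF ij reg[OF ij]])
    fix a :: "nat \<times> nat \<Rightarrow> real" and t
    define p q where "p = min i j" and "q = max i j"
    have p: "(p, q) \<in> goe_idx n" using ij by (auto simp: p_def q_def goe_idx_def)
    let ?a = "a((p, q) := t)"
    let ?w = "complex_of_real (weight (p, q))"
    let ?S = "\<Sum>l\<in>{1..M}. 2 * of_nat (l * f l) * scale l * P (Suc l) p q ?a * Phi_dec f M l ?a"
    have "((\<lambda>t. G j i (a((p, q) := t)) * Phi f M (a((p, q) := t))) has_vector_derivative
      G j i ?a * (- ?w * ?S) + - ?w * (G j p ?a * G q i ?a + G j q ?a * G p i ?a) * Phi f M ?a) (at t)"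
      by (intro has_vector_derivative_mult has_vector_derivative_G has_vector_derivative_Phi p ij)
    also have "G j i ?a * (- ?w * ?S) + - ?w * (G j p ?a * G q i ?a + G j q ?a * G p i ?a) * Phi f M ?a =
       - ?w * ((G j p ?a * G q i ?a + G j q ?a * G p i ?a) * Phi f M ?a + G j i ?a * ?S)"
      by (simp only: algebra_simps)
    \<comment> \<open>The parameter is the ordered pair \<open>(p, q)\<close>, but the expression is
      symmetric in the pair, so \<open>(i, j)\<close> may be put back.\<close>
    also have "G j p ?a * G q i ?a + G j q ?a * G p i ?a = G i j ?a * G j i ?a + G i i ?a * G j j ?a"
      using ij G_commute[of i j ?a] by (auto simp: p_def q_def min_def max_def mult.commute simp del: fun_upd_apply)
    also have "G j i ?a * ?S = (\<Sum>l\<in>{1..M}. 2 * of_nat (l * f l) * scale l * (P (Suc l) i j ?a * G j i ?a) * Phi_dec f M l ?a)"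
    proof -
      have "P (Suc l) p q ?a = P (Suc l) i j ?a" for l
        using ij P_commute[of i j] by (auto simp: p_def q_def min_def max_def simp del: fun_upd_apply)
      then show ?thesis by (simp add: sum_distrib_left mult_ac del: fun_upd_apply)
    qed
    finally show "((\<lambda>t. G j i (a((min i j, max i j) := t)) * Phi f M (a((min i j, max i j) := t))) has_vector_derivative
      - complex_of_real (weight (min i j, max i j)) * H i j (a((min i j, max i j) := t))) (at t)"
      unfolding H_def p_def q_def .
  qed
  have "(LINT a|goe n. (of_nat n + w * T 1 a) * Phi f M a) =
      (LINT a|goe n. (\<Sum>i<n. \<Sum>j<n. entry a i j * (G j i a * Phi f M a)))"
    unfolding resolvent_trace_identity[symmetric] by (simp only: sum_distrib_right mult.assoc)
  also have "\<dots> = (\<Sum>i<n. \<Sum>j<n. LINT a|goe n. entry a i j * (G j i a * Phi f M a))"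
    by (subst Bochner_Integration.integral_sum)
      (auto intro!: Bochner_Integration.integral_sum sum.cong Bochner_Integration.integrable_sum integrable_entry_regular reg)
  also have "\<dots> = (\<Sum>i<n. \<Sum>j<n. - (1 / of_nat n) * (LINT a|goe n. H i j a))"
    by (intro sum.cong refl ibp) auto
  also have "\<dots> = - (1 / of_nat n) * (LINT a|goe n. (\<Sum>i<n. \<Sum>j<n. H i j a))"
    unfolding sum_distrib_left[symmetric]
    by (subst Bochner_Integration.integral_sum)
      (auto intro!: Bochner_Integration.integral_sum[symmetric] sum.cong arg_cong2[of _ _ _ _ "(*)"] Bochner_Integration.integrable_sum integrable_regular regular_sum reg)
  also have "(\<lambda>a. \<Sum>i<n. \<Sum>j<n. H i j a) = (\<lambda>a. (T 2 a + (T 1 a)\<^sup>2) * Phi f M a +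
      (\<Sum>l\<in>{1..M}. 2 * of_nat (l * f l) * scale l * T (l + 2) a * Phi_dec f M l a))"
  proof
    fix a
    \<comment> \<open>Summing over \<open>i\<close> and \<open>j\<close> closes the product into a
      trace; the case \<open>l = 0\<close> also supplies the term \<open>T 2 a\<close>.\<close>
    have T2: "(\<Sum>i<n. \<Sum>j<n. P (Suc l) i j a * G j i a) = T (l + 2) a" for l
      unfolding T_def by (intro sum.cong refl) (simp add: P_Suc(1)[of _ _ "Suc l"])
    have T1: "(\<Sum>i<n. \<Sum>j<n. G i i a * G j j a) = (T 1 a)\<^sup>2"
      by (simp add: T_def power2_eq_square sum_product)
    have "(\<Sum>i<n. \<Sum>j<n. H i j a) =
      ((\<Sum>i<n. \<Sum>j<n. G i j a * G j i a) + (\<Sum>i<n. \<Sum>j<n. G i i a * G j j a)) * Phi f M a +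
      (\<Sum>i<n. \<Sum>j<n. \<Sum>l\<in>{1..M}. 2 * of_nat (l * f l) * scale l * (P (Suc l) i j a * G j i a) * Phi_dec f M l a)"
      unfolding H_def sum.distrib sum_distrib_right distrib_right by simp
    also have "(\<Sum>i<n. \<Sum>j<n. \<Sum>l\<in>{1..M}. 2 * of_nat (l * f l) * scale l * (P (Suc l) i j a * G j i a) * Phi_dec f M l a) =
      (\<Sum>i<n. \<Sum>l\<in>{1..M}. \<Sum>j<n. 2 * of_nat (l * f l) * scale l * (P (Suc l) i j a * G j i a) * Phi_dec f M l a)"
      by (intro sum.cong refl sum.swap)
    also have "\<dots> = (\<Sum>l\<in>{1..M}. \<Sum>i<n. \<Sum>j<n. 2 * of_nat (l * f l) * scale l * (P (Suc l) i j a * G j i a) * Phi_dec f M l a)"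
      by (rule sum.swap)
    also have "\<dots> = (\<Sum>l\<in>{1..M}. 2 * of_nat (l * f l) * scale l * T (l + 2) a * Phi_dec f M l a)"
      unfolding T2[symmetric] by (simp only: sum_distrib_left sum_distrib_right)
    finally show "(\<Sum>i<n. \<Sum>j<n. H i j a) = (T 2 a + (T 1 a)\<^sup>2) * Phi f M a +
      (\<Sum>l\<in>{1..M}. 2 * of_nat (l * f l) * scale l * T (l + 2) a * Phi_dec f M l a)"
      using T2[of 0] T1 by (simp add: numeral_2_eq_2)
  qed
  finally show ?thesis .
qed

section \<open>Rescaling by powers of \<open>n^(1/3)\<close>\<close>

text \<open>All scaling factors are integer powers of \<open>X\<close>, which reduces the rescaling
  to polynomial algebra.\<close>

definition X :: complex where "X = complex_of_real (real n powr (1/3))"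

lemma X_nonzero: "X \<noteq> 0"
  using n_pos by (simp add: X_def)

lemma X_cubed: "X ^ 3 = of_nat n"
proof -
  have "(real n powr (1/3)) ^ 3 = real n"
    using n_pos by (simp flip: powr_realpow add: powr_powr)
  then show ?thesis unfolding X_def by (metis of_real_of_nat_eq of_real_power)
qed

lemma scale_eq: "scale l = 1 / X ^ (2 * l)"
proof -
  have "(real n powr (1/3)) ^ (2 * l) = real n powr (2 * real l / 3)"
    using n_pos by (simp flip: powr_realpow add: powr_powr)
  then have "real n powr (- 2 * real l / 3) = 1 / (real n powr (1/3)) ^ (2 * l)"
    by (simp add: powr_minus_divide)
  then show ?thesis by (simp add: scale_def X_def)
qed

lemma w_eq: "w = 2 + z / X ^ 2"
  using scale_eq[of 1] by (simp add: w_def scale_def)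

lemma T_eq_h: "T 1 a = X ^ 2 * h 1 a - X ^ 3" "l \<ge> 2 \<Longrightarrow> T l a = X ^ (2 * l) * h l a"
  using X_nonzero by (simp_all add: h_eq scale_eq X_cubed)

text \<open>After rescaling, the terms with \<open>X^3\<close> and \<open>2 * X^2\<close> agree on
  both sides: this is the effect of the shift by 2 and the centring by \<open>n\<close>. Dividing
  the rest by \<open>X\<close> leaves \<open>z / X\<close> in front of the first-order term.\<close>

lemma loop_equation:
  "z * (LINT a|goe n. Phi f M a) - (LINT a|goe n. (h 1 a)\<^sup>2 * Phi f M a) - (LINT a|goe n. h 2 a * Phi f M a)
    - 2 * (\<Sum>l\<in>{1..M}. of_nat (l * f l) * (LINT a|goe n. h (l + 2) a * Phi_dec f M l a))
    = z / X * (LINT a|goe n. h 1 a * Phi f M a)"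
proof -
  have int: "integrable (goe n) (\<lambda>a. Phi f M a)" "integrable (goe n) (\<lambda>a. h l a * Phi f M a)"
    "integrable (goe n) (\<lambda>a. (h l a)\<^sup>2 * Phi f M a)" "integrable (goe n) (\<lambda>a. h l a * Phi_dec f M m a)" for l m
    by (intro integrable_regular regular_intros)+
  have "(LINT a|goe n. (of_nat n + w * T 1 a) * Phi f M a) =
      (LINT a|goe n. (- (X ^ 3) - z * X) * Phi f M a + (2 * X ^ 2 + z) * (h 1 a * Phi f M a))"
    using X_nonzero unfolding T_eq_h w_eq X_cubed[symmetric]
    by (intro Bochner_Integration.integral_cong refl) (simp add: field_simps power2_eq_square power3_eq_cube)
  also have "\<dots> = (- (X ^ 3) - z * X) * (LINT a|goe n. Phi f M a) + (2 * X ^ 2 + z) * (LINT a|goe n. h 1 a * Phi f M a)"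
    using int by simp
  finally have L: "(LINT a|goe n. (of_nat n + w * T 1 a) * Phi f M a) = \<dots>" .
  have "(LINT a|goe n. (T 2 a + (T 1 a)\<^sup>2) * Phi f M a +
      (\<Sum>l\<in>{1..M}. 2 * of_nat (l * f l) * scale l * T (l + 2) a * Phi_dec f M l a)) =
    (LINT a|goe n. X ^ 4 * (h 2 a * Phi f M a) + X ^ 4 * ((h 1 a)\<^sup>2 * Phi f M a) - 2 * X ^ 5 * (h 1 a * Phi f M a) +
       X ^ 6 * Phi f M a + (\<Sum>l\<in>{1..M}. 2 * X ^ 4 * of_nat (l * f l) * (h (l + 2) a * Phi_dec f M l a)))"
  proof (intro Bochner_Integration.integral_cong refl arg_cong2[of _ _ _ _ "(+)"] sum.cong)
    fix a l
    show "(T 2 a + (T 1 a)\<^sup>2) * Phi f M a = X ^ 4 * (h 2 a * Phi f M a) + X ^ 4 * ((h 1 a)\<^sup>2 * Phi f M a)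
        - 2 * X ^ 5 * (h 1 a * Phi f M a) + X ^ 6 * Phi f M a"
      unfolding T_eq_h(1) T_eq_h(2)[OF order_refl] by (simp add: algebra_simps power2_eq_square power_numeral_reduce)
    show "2 * of_nat (l * f l) * scale l * T (l + 2) a * Phi_dec f M l a =
        2 * X ^ 4 * of_nat (l * f l) * (h (l + 2) a * Phi_dec f M l a)"
    proof -
      \<comment> \<open>The powers of \<open>X\<close> combine to \<open>X^4\<close> for every
        \<open>l\<close>, so the whole sum carries one common factor.\<close>
      have "scale l * T (l + 2) a = X ^ 4 * h (l + 2) a"
        using X_nonzero T_eq_h(2)[of "l + 2" a] by (simp add: scale_eq power_add power4_eq_xxxx)
      then show ?thesis by (simp add: mult_ac)
    qed
  qed
  also have "\<dots> = X ^ 4 * (LINT a|goe n. h 2 a * Phi f M a) + X ^ 4 * (LINT a|goe n. (h 1 a)\<^sup>2 * Phi f M a)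
      - 2 * X ^ 5 * (LINT a|goe n. h 1 a * Phi f M a) + X ^ 6 * (LINT a|goe n. Phi f M a)
      + (\<Sum>l\<in>{1..M}. 2 * X ^ 4 * of_nat (l * f l) * (LINT a|goe n. h (l + 2) a * Phi_dec f M l a))"
    using int by simp
  finally have R: "(LINT a|goe n. (T 2 a + (T 1 a)\<^sup>2) * Phi f M a +
      (\<Sum>l\<in>{1..M}. 2 * of_nat (l * f l) * scale l * T (l + 2) a * Phi_dec f M l a)) = \<dots>" .
  define S where "S = (\<Sum>l\<in>{1..M}. of_nat (l * f l) * (LINT a|goe n. h (l + 2) a * Phi_dec f M l a))"
  have "(\<Sum>l\<in>{1..M}. 2 * X ^ 4 * of_nat (l * f l) * (LINT a|goe n. h (l + 2) a * Phi_dec f M l a)) = 2 * X ^ 4 * S"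
    by (simp only: S_def sum_distrib_left mult.assoc)
  note eq = loop_equation_unscaled[of f M, unfolded L R this, folded X_cubed]
  define I0 I1 I11 I2 where "I0 = (LINT a|goe n. Phi f M a)" and "I1 = (LINT a|goe n. h 1 a * Phi f M a)"
    and "I11 = (LINT a|goe n. (h 1 a)\<^sup>2 * Phi f M a)" and "I2 = (LINT a|goe n. h 2 a * Phi f M a)"
  have "(- (X ^ 3) - z * X) * I0 + (2 * X ^ 2 + z) * I1 =
      - (1 / X ^ 3) * (X ^ 4 * I2 + X ^ 4 * I11 - 2 * X ^ 5 * I1 + X ^ 6 * I0 + 2 * X ^ 4 * S)"
    using eq unfolding I0_def I1_def I11_def I2_def .
  also have "\<dots> = - (X * I2 + X * I11 - 2 * X ^ 2 * I1 + X ^ 3 * I0 + 2 * X * S)"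
    using X_nonzero by (simp add: field_simps power_numeral_reduce)
  finally have "X * (z * I0 - I11 - I2 - 2 * S) = z * I1"
    by (simp add: algebra_simps)
  then show ?thesis
    using X_nonzero unfolding S_def[symmetric] I0_def[symmetric] I1_def[symmetric] I11_def[symmetric] I2_def[symmetric]
    by (simp add: field_simps)
qed

section \<open>From monomials to moments\<close>

text \<open>Components beyond the length are zero and contribute factors 1, so any sufficiently
  large cutoff gives the same moment.\<close>

lemma mK_eq_Phi:
  assumes "length K \<le> M" "1 \<le> M"
  shows "mK n z K = (LINT a|goe n. Phi (mcomp K) M a)"
proof -
  have "Phi (mcomp K) M a = gc1 n z a ^ mcomp K 1 * (\<Prod>l\<in>{2..length K}. gnk n l z a ^ mcomp K l)" for a
  proof -
    have "{1..M} = insert 1 {2..M}" using assms by auto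
    then have "Phi (mcomp K) M a = h 1 a ^ mcomp K 1 * (\<Prod>l\<in>{2..M}. h l a ^ mcomp K l)"
      by (simp add: Phi_def)
    also have "(\<Prod>l\<in>{2..M}. h l a ^ mcomp K l) = (\<Prod>l\<in>{2..length K}. h l a ^ mcomp K l)"
      using assms by (intro prod.mono_neutral_right) (auto simp: mcomp_def)
    also have "\<dots> = (\<Prod>l\<in>{2..length K}. gnk n l z a ^ mcomp K l)"
      by (intro prod.cong) (auto simp: h_def)
    finally show ?thesis by (simp add: h_def)
  qed
  then show ?thesis by (simp add: mK_def)
qed

lemma Phi_madd: "Phi (mcomp (madd K L)) M a = Phi (mcomp K) M a * Phi (mcomp L) M a"
  by (simp add: Phi_def mcomp_madd power_add prod.distrib)

lemma Phi_unit_mi: "1 \<le> l \<Longrightarrow> l \<le> M \<Longrightarrow> Phi (mcomp (unit_mi l)) M a = h l a"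
  by (simp add: Phi_def mcomp_unit_mi if_distrib cong: if_cong)

lemma Phi_msub_unit_mi:
  assumes "1 \<le> l" "l \<le> M"
  shows "Phi (mcomp (msub K (unit_mi l))) M a = Phi_dec (mcomp K) M l a"
  using assms unfolding Phi_def Phi_dec_def
  by (subst prod.remove[of _ l]) (auto simp: mcomp_msub mcomp_unit_mi)

lemma mK_loop_equation:
  "mK n z K * z - mK n z (madd K (madd (unit_mi 1) (unit_mi 1))) - mK n z (madd K (unit_mi 2))
    - 2 * (\<Sum>l\<in>{1..length K}. if mcomp K l = 0 then 0
        else of_nat (l * mcomp K l) * mK n z (madd (msub K (unit_mi l)) (unit_mi (l + 2))))
    = z / X * mK n z (madd K (unit_mi 1))"
proof -
  \<comment> \<open>The largest index needed is \<open>length K + 2\<close>, reached when the last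
    component is traded for the one two places higher.\<close>
  define M where "M = length K + 2"
  have len: "length K \<le> M" "length (madd K (madd (unit_mi 1) (unit_mi 1))) \<le> M"
    "length (madd K (unit_mi 2)) \<le> M" "length (madd K (unit_mi 1)) \<le> M" "1 \<le> M" "2 \<le> M"
    by (auto simp: M_def length_madd length_unit_mi)
  have l: "mK n z (madd (msub K (unit_mi l)) (unit_mi (l + 2))) =
      (LINT a|goe n. h (l + 2) a * Phi_dec (mcomp K) M l a)" if "l \<in> {1..length K}" for l
    using that mK_eq_Phi[of "madd (msub K (unit_mi l)) (unit_mi (l + 2))" M]
    by (simp add: M_def length_madd length_msub length_unit_mi Phi_madd Phi_unit_mi Phi_msub_unit_mi mult.commute)
  \<comment> \<open>The convention for vanishing components agrees with the coefficient
    \<open>l * mcomp K l\<close>, which is then zero.\<close>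
  have "(\<Sum>l\<in>{1..length K}. if mcomp K l = 0 then 0
        else of_nat (l * mcomp K l) * mK n z (madd (msub K (unit_mi l)) (unit_mi (l + 2)))) =
      (\<Sum>l\<in>{1..length K}. of_nat (l * mcomp K l) * (LINT a|goe n. h (l + 2) a * Phi_dec (mcomp K) M l a))"
    using l by (intro sum.cong) auto
  also have "\<dots> = (\<Sum>l\<in>{1..M}. of_nat (l * mcomp K l) * (LINT a|goe n. h (l + 2) a * Phi_dec (mcomp K) M l a))"
    by (intro sum.mono_neutral_left) (auto simp: M_def mcomp_def)
  finally have S: "(\<Sum>l\<in>{1..length K}. if mcomp K l = 0 then 0
        else of_nat (l * mcomp K l) * mK n z (madd (msub K (unit_mi l)) (unit_mi (l + 2)))) = \<dots>" .
  show ?thesis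
    using loop_equation[of "mcomp K" M] len unfolding S
    by (simp add: mK_eq_Phi[of _ M] Phi_madd Phi_unit_mi power2_eq_square mult_ac)
qed

end

section \<open>The asymptotic statement\<close>

lemma bigO_seq_zero: "bigO_seq (\<lambda>n. 0) p"
  unfolding bigO_seq_def by (auto intro!: exI[of _ 0])

lemma bigO_seq_const_times_powr: "bigO_seq (\<lambda>n. c / complex_of_real (real n powr p)) p"
  unfolding bigO_seq_def
  by (rule exI[of _ "cmod c"]) (auto simp: norm_divide powr_minus_divide)

theorem theorem1p1:
  fixes z :: complex
  assumes "Im z \<noteq> 0"
  shows
   "(\<forall>K. length K \<ge> 1 \<longrightarrow> (\<exists>l\<in>set K. l \<noteq> 0) \<longrightarrow>
      (\<exists>\<epsilon>0 \<epsilon>1 \<epsilon>2 \<epsilon>3 \<eta>.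
         bigO_seq \<epsilon>0 (2/3) \<and> bigO_seq \<epsilon>1 (2/3) \<and> bigO_seq \<epsilon>2 (2/3) \<and>
         (\<forall>l\<in>{1..length K}. bigO_seq (\<epsilon>3 l) (2/3)) \<and> bigO_seq \<eta> (1/3) \<and>
         (\<forall>\<^sub>F n in sequentially.
            mK n z K * (z + \<epsilon>0 n)
            - mK n z (madd K (madd (unit_mi 1) (unit_mi 1))) * (1 + \<epsilon>1 n)
            - mK n z (madd K (unit_mi 2)) * (1 + \<epsilon>2 n)
            - 2 * (\<Sum>l\<in>{1..length K}.
                     (if mcomp K l = 0 then 0
                      else of_nat (l * mcomp K l)
                           * mK n z (madd (msub K (unit_mi l)) (unit_mi (l + 2))) * (1 + \<epsilon>3 l n)))
            = \<eta> n * mK n z (madd K (unit_mi 1)))))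
    \<and>
    (\<exists>\<epsilon>0 \<epsilon>1 \<epsilon>2 \<eta>.
         bigO_seq \<epsilon>0 (2/3) \<and> bigO_seq \<epsilon>1 (2/3) \<and> bigO_seq \<epsilon>2 (2/3) \<and> bigO_seq \<eta> (1/3) \<and>
         (\<forall>\<^sub>F n in sequentially.
            z + \<epsilon>0 n
            - mK n z (madd (unit_mi 1) (unit_mi 1)) * (1 + \<epsilon>1 n)
            - mK n z (unit_mi 2) * (1 + \<epsilon>2 n)
            = \<eta> n * mK n z (unit_mi 1)))"
proof -
  define \<eta> where "\<eta> n = z / complex_of_real (real n powr (1/3))" for n
  have \<eta>: "bigO_seq \<eta> (1/3)" unfolding \<eta>_def by (rule bigO_seq_const_times_powr)
  have loop: "mK n z K * z - mK n z (madd K (madd (unit_mi 1) (unit_mi 1))) - mK n z (madd K (unit_mi 2))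
      - 2 * (\<Sum>l\<in>{1..length K}. if mcomp K l = 0 then 0
          else of_nat (l * mcomp K l) * mK n z (madd (msub K (unit_mi l)) (unit_mi (l + 2))))
      = \<eta> n * mK n z (madd K (unit_mi 1))" if "n > 0" for n K
  proof -
    interpret goe_resolvent n z by unfold_locales (use that assms in auto)
    show ?thesis using mK_loop_equation[of K] by (simp add: \<eta>_def X_def)
  qed
  \<comment> \<open>The boundary condition is the exact identity at the empty multi-index, whose
    moment is 1 because \<open>goe n\<close> is a probability measure.\<close>
  have [simp]: "madd [] K = K" for K
    by (rule nth_equalityI) (auto simp: madd_def mcomp_def simp del: upt_Suc)
  have [simp]: "mK n z [] = 1" for n
    using prob_space.prob_space[OF prob_space_goe[of n]] by (simp add: mK_def mcomp_def)
  show ?thesis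
  proof (intro conjI allI impI)
    fix K
    show "\<exists>\<epsilon>0 \<epsilon>1 \<epsilon>2 \<epsilon>3 \<eta>.
         bigO_seq \<epsilon>0 (2/3) \<and> bigO_seq \<epsilon>1 (2/3) \<and> bigO_seq \<epsilon>2 (2/3) \<and>
         (\<forall>l\<in>{1..length K}. bigO_seq (\<epsilon>3 l) (2/3)) \<and> bigO_seq \<eta> (1/3) \<and>
         (\<forall>\<^sub>F n in sequentially.
            mK n z K * (z + \<epsilon>0 n)
            - mK n z (madd K (madd (unit_mi 1) (unit_mi 1))) * (1 + \<epsilon>1 n)
            - mK n z (madd K (unit_mi 2)) * (1 + \<epsilon>2 n)
            - 2 * (\<Sum>l\<in>{1..length K}.
                     (if mcomp K l = 0 then 0
                      else of_nat (l * mcomp K l)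
                           * mK n z (madd (msub K (unit_mi l)) (unit_mi (l + 2))) * (1 + \<epsilon>3 l n)))
            = \<eta> n * mK n z (madd K (unit_mi 1)))"
      \<comment> \<open>The identity is exact, so zero sequences serve as the relative errors;
        passing to large \<open>n\<close> only discards \<open>n = 0\<close>.\<close>
      by (rule exI[of _ "\<lambda>_. 0"], rule exI[of _ "\<lambda>_. 0"], rule exI[of _ "\<lambda>_. 0"], rule exI[of _ "\<lambda>_ _. 0"], rule exI[of _ \<eta>])
        (use loop[of _ K] in \<open>auto simp: bigO_seq_zero \<eta> cong: if_cong intro!: eventually_mono[OF eventually_gt_at_top[of 0]]\<close>)
  next
    show "\<exists>\<epsilon>0 \<epsilon>1 \<epsilon>2 \<eta>.
         bigO_seq \<epsilon>0 (2/3) \<and> bigO_seq \<epsilon>1 (2/3) \<and> bigO_seq \<epsilon>2 (2/3) \<and> bigO_seq \<eta> (1/3) \<and>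
         (\<forall>\<^sub>F n in sequentially.
            z + \<epsilon>0 n
            - mK n z (madd (unit_mi 1) (unit_mi 1)) * (1 + \<epsilon>1 n)
            - mK n z (unit_mi 2) * (1 + \<epsilon>2 n)
            = \<eta> n * mK n z (unit_mi 1))"
      by (rule exI[of _ "\<lambda>_. 0"], rule exI[of _ "\<lambda>_. 0"], rule exI[of _ "\<lambda>_. 0"], rule exI[of _ \<eta>])
        (use loop[of _ "[]"] in \<open>auto simp: bigO_seq_zero \<eta> cong: if_cong intro!: eventually_mono[OF eventually_gt_at_top[of 0]]\<close>)
  qed
qed


end
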